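(* Let $(a_n)_{n\ge1}$ be a sequence of distinct positive real numbers such that $\inf_{1\le m\ne n\le N}|a_m-a_n|\ge1$ for all $N\in\mathbb N$. Then for every $\epsilon>0$ and almost all $\alpha\in[0,1]$, $$\lfloor\delta^{\alpha}_{\min}\rfloor(N)\le\frac{N^{\epsilon}}{H_N}\quad\text{for all except finitely many }N,$$ where $\lfloor\delta^{\alpha}_{\min}\rfloor(N)=\min_{1\le m\ne n\le N}\|\alpha\lfloor|a_m-a_n|\rfloor\|$ and $H_N=\#\{\lfloor|a_m-a_n|\rfloor:1\le m\ne n\le N\}$.
   Context: $\|x\|=\min_{k\in\mathbb Z}|x-k|$. "Almost all" refers to Lebesgue measure. *)

theory Defs
  imports "HOL-Analysis.Analysis"
begin

definition dist_int :: "real \<Rightarrow> real" where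
  "dist_int x = (INF k::int. \<bar>x - of_int k\<bar>)"

text \<open>The infimum over all integers is attained, so it is indeed a minimum.\<close>

lemma dist_int_le: "dist_int x \<le> \<bar>x - of_int k\<bar>"
  unfolding dist_int_def by (intro cINF_lower bdd_belowI[where m = 0]) auto

lemma dist_int_attained: "\<exists>k::int. dist_int x = \<bar>x - of_int k\<bar>"
proof -
  have "dist_int x = \<bar>x - of_int (round x)\<bar>"
  proof (rule antisym)
    show "\<bar>x - of_int (round x)\<bar> \<le> dist_int x"
      unfolding dist_int_def
      by (intro cINF_greatest) (auto intro: round_diff_minimal)
  qed (rule dist_int_le)
  then show ?thesis ..
qed

definition index_pairs :: "nat \<Rightarrow> (nat \<times> nat) set" where
  "index_pairs N = {(m, n). m \<in> {1..N} \<and> n \<in> {1..N} \<and> m \<noteq> n}"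

text \<open>For \<open>N \<le> 1\<close> there are no pairs and the value of \<open>Min\<close> is meaningless.\<close>

definition floor_delta_min :: "(nat \<Rightarrow> real) \<Rightarrow> real \<Rightarrow> nat \<Rightarrow> real" where
  "floor_delta_min a \<alpha> N =
     Min ((\<lambda>(m, n). dist_int (\<alpha> * of_int \<lfloor>\<bar>a m - a n\<bar>\<rfloor>)) ` index_pairs N)"

definition num_floor_diffs :: "(nat \<Rightarrow> real) \<Rightarrow> nat \<Rightarrow> nat" where
  "num_floor_diffs a N = card ((\<lambda>(m, n). \<lfloor>\<bar>a m - a n\<bar>\<rfloor>) ` index_pairs N)"

end

theory Submission
  imports Defs
begin

text \<open>
  Let \<open>D\<close> be a set of \<open>H\<close> positive integers. Averaging over rational shifts shows that the events
  \<open>\<parallel>d \<alpha>\<parallel> \<le> \<delta>\<close>, \<open>d \<in> D\<close>, have probability \<open>2 \<delta>\<close> and pairwise covariance at most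
  \<open>2 \<delta> gcd(d, e) / max(d, e)\<close>. By Chebyshev's inequality the probability that none of them occurs
  is at most \<open>S / (2 \<delta> H\<^sup>2)\<close>, where \<open>S = \<Sum> gcd(d, e) / max(d, e)\<close>.

  The sum satisfies \<open>S \<le> C H\<^bsup>1 + \<eta>\<^esup>\<close> for every \<open>\<eta> > 0\<close>: up to an error \<open>H\<close> one may
  keep only the ratios \<open>d / e = p / q\<close> with \<open>p, q \<le> H\<close>; by Cauchy-Schwarz the \<open>k\<close>-th power of \<open>S\<close>
  is at most \<open>H\<^bsup>k - 1\<^esup>\<close> times the sum of the entries of the \<open>k\<close>-th power of the kernel, and each of
  these \<open>H\<^sup>2\<close> entries is bounded by a moment of the divisor function, hence by a power of \<open>log H\<close>.

  Hence for \<open>\<delta> = H\<^bsup>2 \<eta> - 1\<^esup>\<close> the failure probability is \<open>O(H\<^bsup>- \<eta>\<^esup>)\<close>, which is summable along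
  the first \<open>N\<close> with \<open>H\<^sub>N\<close> in \<open>[2\<^sup>k, 2\<^bsup>k + 1\<^esup>)\<close>. Since the minimum decreases in \<open>N\<close>, the
  Borel-Cantelli lemma controls all \<open>N\<close>.
\<close>

subsection \<open>Powers of a kernel\<close>

text \<open>\<open>sq_kernel D K i\<close> is the matrix power of \<open>K\<close>, restricted to \<open>D\<close>, with exponent \<open>2 ^ i\<close>.\<close>

fun sq_kernel :: "'a set \<Rightarrow> ('a \<Rightarrow> 'a \<Rightarrow> real) \<Rightarrow> nat \<Rightarrow> 'a \<Rightarrow> 'a \<Rightarrow> real" where
  "sq_kernel D K 0 d e = K d e"
| "sq_kernel D K (Suc i) d e = (\<Sum>f\<in>D. sq_kernel D K i d f * sq_kernel D K i f e)"

lemma sq_kernel_sym: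
  assumes "\<And>d e. K d e = K e d"
  shows "sq_kernel D K i d e = sq_kernel D K i e d"
proof (induction i arbitrary: d e)
  case (Suc i)
  have "sq_kernel D K i d f * sq_kernel D K i f e = sq_kernel D K i e f * sq_kernel D K i f d" for f
    using Suc[of d f] Suc[of f e] by simp
  then show ?case by simp
qed (use assms in simp)

lemma sq_kernel_nonneg:
  assumes "\<And>d e. K d e \<ge> 0"
  shows "sq_kernel D K i d e \<ge> 0"
  using assms by (induction i arbitrary: d e) (auto intro!: sum_nonneg mult_nonneg_nonneg)

text \<open>By symmetry the entries of the square of a kernel sum to the sum of the squared row sums, so
  Cauchy-Schwarz gives the induction step.\<close>

lemma sum_kernel_power_le:
  assumes "finite D" "\<And>d e. K d e = K e d" "\<And>d e. K d e \<ge> 0"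
  shows "(\<Sum>d\<in>D. \<Sum>e\<in>D. K d e) ^ (2 ^ i)
           \<le> real (card D) ^ (2 ^ i - 1) * (\<Sum>d\<in>D. \<Sum>e\<in>D. sq_kernel D K i d e)"
proof (induction i)
  case (Suc i)
  let ?K = "sq_kernel D K i"
  let ?W = "\<Sum>d\<in>D. \<Sum>e\<in>D. ?K d e"
  have W0: "0 \<le> (\<Sum>d\<in>D. \<Sum>e\<in>D. K d e)"
    using assms by (intro sum_nonneg) auto
  have "(\<Sum>d\<in>D. \<Sum>e\<in>D. sq_kernel D K (Suc i) d e) = (\<Sum>d\<in>D. \<Sum>f\<in>D. \<Sum>e\<in>D. ?K d f * ?K f e)"
    unfolding sq_kernel.simps by (intro sum.cong refl sum.swap)
  also have "\<dots> = (\<Sum>f\<in>D. \<Sum>d\<in>D. \<Sum>e\<in>D. ?K d f * ?K f e)"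
    by (rule sum.swap)
  also have "\<dots> = (\<Sum>f\<in>D. (\<Sum>e\<in>D. ?K f e)\<^sup>2)"
    unfolding power2_eq_square sum_product
    by (intro sum.cong refl arg_cong2[of _ _ _ _ "(*)"] sq_kernel_sym assms(2))
  finally have eq: "(\<Sum>d\<in>D. \<Sum>e\<in>D. sq_kernel D K (Suc i) d e) = (\<Sum>f\<in>D. (\<Sum>e\<in>D. ?K f e)\<^sup>2)" .
  have cs: "?W\<^sup>2 \<le> (\<Sum>f\<in>D. (\<Sum>e\<in>D. ?K f e)\<^sup>2) * card D"
    by (rule sum_squared_le_sum_of_squares)
  have "(\<Sum>d\<in>D. \<Sum>e\<in>D. K d e) ^ (2 ^ Suc i) = ((\<Sum>d\<in>D. \<Sum>e\<in>D. K d e) ^ (2 ^ i))\<^sup>2"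
    by (simp add: power_mult[symmetric] mult.commute)
  also have "\<dots> \<le> (real (card D) ^ (2 ^ i - 1) * ?W)\<^sup>2"
    using Suc W0 by (intro power_mono) auto
  also have "\<dots> = (real (card D) ^ (2 ^ i - 1))\<^sup>2 * ?W\<^sup>2"
    by (simp add: power_mult_distrib)
  also have "\<dots> \<le> (real (card D) ^ (2 ^ i - 1))\<^sup>2 * ((\<Sum>f\<in>D. (\<Sum>e\<in>D. ?K f e)\<^sup>2) * card D)"
    using cs by (intro mult_left_mono) auto
  also have "\<dots> = real (card D) ^ (2 * (2 ^ i - 1) + 1) * (\<Sum>f\<in>D. (\<Sum>e\<in>D. ?K f e)\<^sup>2)"
    by (simp add: power_mult[symmetric] mult_ac)
  also have "2 * (2 ^ i - 1) + 1 = (2 ^ Suc i - 1 :: nat)"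
    by (cases "2 ^ i :: nat") auto
  finally show ?case using eq by simp
qed simp

subsection \<open>Divisor sums\<close>

definition num_divs :: "nat \<Rightarrow> nat" where
  "num_divs n = card {k. k dvd n}"

lemma num_divs_mono: "m dvd n \<Longrightarrow> n > 0 \<Longrightarrow> num_divs m \<le> num_divs n"
  unfolding num_divs_def by (rule card_mono) (auto intro: dvd_trans)

text \<open>Every divisor of \<open>a * b\<close> is a divisor of \<open>a\<close> times a divisor
  of \<open>b\<close>, so multiplication maps the pairs of divisors onto the divisors of the
  product.\<close>

lemma num_divs_mult_le:
  assumes "a > 0" "b > 0"
  shows "num_divs (a * b) \<le> num_divs a * num_divs b"
proof -
  have "{k. k dvd a * b} \<subseteq> (\<lambda>(x, y). x * y) ` ({k. k dvd a} \<times> {k. k dvd b})"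
  proof
    fix k assume "k \<in> {k. k dvd a * b}"
    then obtain x y where "k = x * y" "x dvd a" "y dvd b"
      using division_decomp[of k a b] by auto
    then show "k \<in> (\<lambda>(x, y). x * y) ` ({k. k dvd a} \<times> {k. k dvd b})" by auto
  qed
  then have "card {k. k dvd a * b} \<le> card ({k. k dvd a} \<times> {k. k dvd b})"
    using assms by (intro surj_card_le) auto
  then show ?thesis by (simp add: num_divs_def card_cartesian_product)
qed

lemma sum_inverse_le_ln:
  assumes "X \<ge> 1"
  shows "(\<Sum>n = 1..X. 1 / real n) \<le> 1 + ln X"
  using assms
proof (induction X rule: dec_induct)
  case (step n)
  \<comment> \<open>The bound \<open>ln y \<le> y - 1\<close> at \<open>y = n / (n + 1)\<close>
    makes the harmonic sum telescope against \<open>ln\<close>.\<close>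
  have "ln (real n / real (Suc n)) \<le> real n / real (Suc n) - 1"
    using step by (intro ln_le_minus_one) auto
  also have "\<dots> = - (1 / real (Suc n))" by (simp add: field_simps)
  finally have "1 / real (Suc n) \<le> ln (real (Suc n)) - ln (real n)"
    using step by (simp add: ln_div)
  then show ?case using step by simp
qed simp

text \<open>Writing one factor \<open>num_divs n\<close> as a sum over \<open>n = k * l\<close>, submultiplicativity bounds the sum
  for \<open>j + 1\<close> by the square of the sum for \<open>j\<close>.\<close>

lemma sum_num_divs_power_le:
  assumes "X \<ge> 1"
  shows "(\<Sum>n = 1..X. real (num_divs n) ^ j / n) \<le> (1 + ln X) ^ (2 ^ j)"
proof (induction j)
  case 0
  then show ?case using sum_inverse_le_ln[OF assms] by simp
next
  case (Suc j)
  let ?T = "\<lambda>n. real (num_divs n) ^ j / n"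
  let ?S = "{(n, k). n \<in> {1..X} \<and> k dvd n}"
  have fin: "finite ?S"
    by (rule finite_subset[of _ "{1..X} \<times> {..X}"]) (auto dest!: dvd_imp_le)
  have "(\<Sum>n = 1..X. real (num_divs n) ^ Suc j / n) = (\<Sum>n = 1..X. \<Sum>k | k dvd n. ?T n)"
    by (simp add: num_divs_def)
  also have "\<dots> = (\<Sum>(n, k)\<in>?S. ?T n)"
    by (subst sum.Sigma) (auto simp: Sigma_def intro!: sum.cong)
  also have "\<dots> \<le> (\<Sum>(n, k)\<in>?S. ?T k * ?T (n div k))"
  proof (intro sum_mono, clarify)
    fix n k assume nk: "n \<in> {1..X}" "k dvd n"
    then obtain l where l: "n = k * l" by auto
    have "k > 0" "l > 0" using nk l by auto
    then have "real (num_divs n) ^ j \<le> (real (num_divs k) * real (num_divs l)) ^ j"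
      unfolding l using num_divs_mult_le[of k l]
      by (intro power_mono) (simp_all flip: of_nat_mult)
    then show "?T n \<le> ?T k * ?T (n div k)"
      using \<open>k > 0\<close> \<open>l > 0\<close> l by (simp add: power_mult_distrib divide_right_mono)
  qed
  also have "\<dots> = (\<Sum>(k, l)\<in>(\<lambda>(n, k). (k, n div k)) ` ?S. ?T k * ?T l)"
    by (subst sum.reindex) (auto simp: inj_on_def case_prod_unfold elim!: dvdE)
  also have "\<dots> \<le> (\<Sum>(k, l)\<in>{1..X} \<times> {1..X}. ?T k * ?T l)"
  proof (rule sum_mono2)
    show "(\<lambda>(n, k). (k, n div k)) ` ?S \<subseteq> {1..X} \<times> {1..X}"
    proof clarify
      fix n k assume "n \<in> {1..X}" "k dvd n"
      then have "k \<in> {1..n}" "n div k \<in> {1..n}"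
        by (auto simp: Suc_le_eq dvd_imp_le dvd_pos_nat div_greater_zero_iff)
      then show "k \<in> {1..X} \<and> n div k \<in> {1..X}"
        using \<open>n \<in> {1..X}\<close> by (meson atLeastAtMost_iff order_trans)
    qed
  qed auto
  also have "\<dots> = (\<Sum>n = 1..X. ?T n)\<^sup>2"
    by (simp add: power2_eq_square sum_product sum.cartesian_product)
  also have "\<dots> \<le> ((1 + ln X) ^ (2 ^ j))\<^sup>2"
    using Suc by (intro power_mono sum_nonneg) auto
  also have "\<dots> = (1 + ln X) ^ (2 ^ Suc j)"
    by (simp add: power_mult[symmetric] mult.commute)
  finally show ?case .
qed

subsection \<open>Ratio kernels\<close>

text \<open>A weighted count of the ways to write \<open>d / e\<close> as a fraction
  \<open>m / n\<close> with entries up to \<open>X\<close>. The fractions need not be reduced, so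
  that products of such fractions are again of this kind and the kernels can be composed.\<close>

definition ratio_kernel :: "nat \<Rightarrow> (nat \<Rightarrow> real) \<Rightarrow> nat \<Rightarrow> nat \<Rightarrow> real" where
  "ratio_kernel X F d e = (\<Sum>n = 1..X. \<Sum>m = 1..X. if n * d = m * e then F n * F m else 0)"

text \<open>By the arithmetic-geometric mean inequality \<open>F n * F m\<close> is at most half the
  sum of the squares; as \<open>d\<close> and \<open>e\<close> are positive, each of
  \<open>n\<close> and \<open>m\<close> determines the other, so each square is counted at most once
  on either side.\<close>

lemma ratio_kernel_le_sum_squares:
  assumes "d > 0" "e > 0"
  shows "ratio_kernel X F d e \<le> (\<Sum>n = 1..X. (F n)\<^sup>2)"
proof -
  have one: "(\<Sum>m = 1..X. if n * d = m * e then c else 0) \<le> c" if "d > 0" "e > 0" "c \<ge> 0" for n d e :: nat and c :: real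
  proof (cases "\<exists>m\<in>{1..X}. n * d = m * e")
    case True
    then obtain m where m: "m \<in> {1..X}" "n * d = m * e" by auto
    then have "(\<Sum>m = 1..X. if n * d = m * e then c else 0) = (\<Sum>m' = 1..X. if m = m' then c else 0)"
      using that by (intro sum.cong) auto
    also have "\<dots> = c" using m by simp
    finally show ?thesis by simp
  next
    case False
    then have "(\<Sum>m = 1..X. if n * d = m * e then c else 0) = 0"
      by (intro sum.neutral) auto
    then show ?thesis using that by simp
  qed
  have "ratio_kernel X F d e \<le> (\<Sum>n = 1..X. \<Sum>m = 1..X.
      (if n * d = m * e then (F n)\<^sup>2 / 2 else 0) + (if m * e = n * d then (F m)\<^sup>2 / 2 else 0))"
    unfolding ratio_kernel_def
  proof (intro sum_mono)
    fix n m
    have "F n * F m \<le> (F n)\<^sup>2 / 2 + (F m)\<^sup>2 / 2"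
      using sum_squares_bound[of "F n" "F m"] by simp
    then show "(if n * d = m * e then F n * F m else 0) \<le>
      (if n * d = m * e then (F n)\<^sup>2 / 2 else 0) + (if m * e = n * d then (F m)\<^sup>2 / 2 else 0)" by auto
  qed
  also have "\<dots> = (\<Sum>n = 1..X. \<Sum>m = 1..X. if n * d = m * e then (F n)\<^sup>2 / 2 else 0)
     + (\<Sum>m = 1..X. \<Sum>n = 1..X. if m * e = n * d then (F m)\<^sup>2 / 2 else 0)"
    by (simp add: sum.distrib) (rule sum.swap)
  also have "\<dots> \<le> (\<Sum>n = 1..X. (F n)\<^sup>2 / 2) + (\<Sum>m = 1..X. (F m)\<^sup>2 / 2)"
    by (intro add_mono sum_mono one assms) auto
  finally show ?thesis by (simp flip: sum.distrib)
qed

lemma ratio_kernel_nonneg: "(\<And>n. F n \<ge> 0) \<Longrightarrow> ratio_kernel X F d e \<ge> 0"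
  unfolding ratio_kernel_def by (intro sum_nonneg) auto

lemma ratio_kernel_mono:
  assumes "\<And>n. n \<in> {1..X} \<Longrightarrow> 0 \<le> F n \<and> F n \<le> G n"
  shows "ratio_kernel X F d e \<le> ratio_kernel X G d e"
proof -
  have "F n * F m \<le> G n * G m" if "n \<in> {1..X}" "m \<in> {1..X}" for n m
    using assms[OF that(1)] assms[OF that(2)] by (intro mult_mono) auto
  then show ?thesis
    unfolding ratio_kernel_def by (intro sum_mono) auto
qed

text \<open>If \<open>n d = m f\<close> and \<open>n' f = m' e\<close>, then \<open>(n n') d = (m m') e\<close>, and \<open>f\<close> is determined by
  \<open>n\<close>, \<open>m\<close> and \<open>d\<close>.\<close>

lemma ratio_kernel_compose:
  assumes "finite D" "\<And>f. f \<in> D \<Longrightarrow> f > 0" "\<And>n. F n \<ge> 0"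
  shows "(\<Sum>f\<in>D. ratio_kernel X F d f * ratio_kernel X F f e)
    \<le> ratio_kernel (X\<^sup>2) (\<lambda>a. \<Sum>x | x \<in> {1..X} \<times> {1..X} \<and> fst x * snd x = a. F (fst x) * F (snd x)) d e"
proof -
  let ?I = "{1..X} \<times> {1..X}"
  let ?p = "\<lambda>x :: nat \<times> nat. fst x * snd x" and ?w = "\<lambda>x. F (fst x) * F (snd x)"
  let ?c = "\<lambda>f (n, n') (m, m'). if n * d = m * f \<and> n' * f = m' * e then F n * F n' * (F m * F m') else 0"
  have img: "?p ` ?I \<subseteq> {1..X\<^sup>2}"
    by (auto simp: power2_eq_square Suc_le_eq intro: mult_le_mono)
  have "(\<Sum>f\<in>D. ratio_kernel X F d f * ratio_kernel X F f e)
      = (\<Sum>f\<in>D. \<Sum>x\<in>?I. \<Sum>y\<in>?I. ?c f x y)"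
  proof (rule sum.cong[OF refl])
    fix f
    have "ratio_kernel X F d f * ratio_kernel X F f e =
       (\<Sum>n = 1..X. \<Sum>n' = 1..X. \<Sum>m = 1..X. \<Sum>m' = 1..X.
          (if n * d = m * f then F n * F m else 0) * (if n' * f = m' * e then F n' * F m' else 0))"
      unfolding ratio_kernel_def by (simp only: sum_product)
    also have "\<dots> = (\<Sum>n = 1..X. \<Sum>n' = 1..X. \<Sum>m = 1..X. \<Sum>m' = 1..X. ?c f (n, n') (m, m'))"
      by (intro sum.cong refl) auto
    also have "\<dots> = (\<Sum>x\<in>?I. \<Sum>y\<in>?I. ?c f x y)"
      by (simp only: sum.cartesian_product' prod.case)
    finally show "ratio_kernel X F d f * ratio_kernel X F f e = (\<Sum>x\<in>?I. \<Sum>y\<in>?I. ?c f x y)" .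
  qed
  also have "\<dots> = (\<Sum>x\<in>?I. \<Sum>y\<in>?I. \<Sum>f\<in>D. ?c f x y)"
    by (subst sum.swap, intro sum.cong refl, rule sum.swap)
  also have "\<dots> \<le> (\<Sum>x\<in>?I. \<Sum>y\<in>?I. if ?p x * d = ?p y * e then ?w x * ?w y else 0)"
  proof (intro sum_mono)
    fix x y assume "x \<in> ?I" "y \<in> ?I"
    obtain n n' m m' where xy: "x = (n, n')" "y = (m, m')" by fastforce
    have pos: "n > 0" "n' > 0" "m > 0" "m' > 0" using \<open>x \<in> ?I\<close> \<open>y \<in> ?I\<close> xy by auto
    have w: "?w x * ?w y \<ge> 0" using assms(3) xy by simp
    show "(\<Sum>f\<in>D. ?c f x y) \<le> (if ?p x * d = ?p y * e then ?w x * ?w y else 0)"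
    proof (cases "\<exists>f\<in>D. n * d = m * f \<and> n' * f = m' * e")
      case True
      then obtain f where f: "f \<in> D" "n * d = m * f" "n' * f = m' * e" by auto
      have "n * n' * d = n' * (m * f)" using f by simp
      also have "\<dots> = m * (m' * e)" using f(3) by (simp add: mult_ac)
      finally have eq: "n * n' * d = m * m' * e" by (simp add: mult_ac)
      have "(\<Sum>g\<in>D. ?c g x y) = (\<Sum>g\<in>D. if f = g then ?w x * ?w y else 0)"
        using f pos by (intro sum.cong refl) (auto simp: xy)
      also have "\<dots> = ?w x * ?w y" using f assms(1) by simp
      finally show ?thesis using eq by (simp add: xy)
    next
      case False
      then have "(\<Sum>f\<in>D. ?c f x y) = 0" by (intro sum.neutral) (auto simp: xy)
      then show ?thesis using w by (simp only:) auto
    qed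
  qed
  \<comment> \<open>The condition involves the pairs only through their products, so the pairs are
    sorted by these products \<open>a\<close> and \<open>b\<close>; what remains of the weights is a
    multiplicative convolution of \<open>F\<close> with itself.\<close>
  also have "\<dots> = (\<Sum>a = 1..X\<^sup>2. \<Sum>x | x \<in> ?I \<and> ?p x = a. \<Sum>b = 1..X\<^sup>2. \<Sum>y | y \<in> ?I \<and> ?p y = b.
      if ?p x * d = ?p y * e then ?w x * ?w y else 0)"
    by (simp only: sum.group[OF _ _ img] finite_atLeastAtMost finite_cartesian_product)
  also have "\<dots> = (\<Sum>a = 1..X\<^sup>2. \<Sum>b = 1..X\<^sup>2. \<Sum>x | x \<in> ?I \<and> ?p x = a. \<Sum>y | y \<in> ?I \<and> ?p y = b.
      if a * d = b * e then ?w x * ?w y else 0)"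
    by (subst sum.swap) (auto intro!: sum.cong)
  also have "\<dots> = (\<Sum>a = 1..X\<^sup>2. \<Sum>b = 1..X\<^sup>2. if a * d = b * e then
      (\<Sum>x | x \<in> ?I \<and> ?p x = a. ?w x) * (\<Sum>y | y \<in> ?I \<and> ?p y = b. ?w y) else 0)"
    by (intro sum.cong refl) (simp add: sum_product)
  finally show ?thesis
    unfolding ratio_kernel_def .
qed

text \<open>The factor \<open>1 / sqrt n\<close> is multiplicative, and its square gives the weight
  \<open>1 / n\<close> of the divisor moments; \<open>j\<close> counts the divisor factors collected
  by repeated convolution.\<close>

abbreviation div_weight :: "nat \<Rightarrow> nat \<Rightarrow> real" where
  "div_weight j n \<equiv> real (num_divs n) ^ j / sqrt n"

text \<open>Both factors of \<open>a\<close> have at most \<open>num_divs a\<close> divisors, and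
  there are at most \<open>num_divs a\<close> factorizations, which accounts for the exponent
  \<open>j + j + 1\<close>.\<close>

lemma div_weight_convolution_le:
  assumes "a > 0"
  shows "(\<Sum>x | x \<in> {1..X} \<times> {1..X} \<and> fst x * snd x = a. div_weight j (fst x) * div_weight j (snd x))
    \<le> div_weight (2 * j + 1) a"
proof -
  let ?S = "{x. x \<in> {1..X} \<times> {1..X} \<and> fst x * snd x = a}"
  have "(\<Sum>x\<in>?S. div_weight j (fst x) * div_weight j (snd x)) \<le> (\<Sum>x\<in>?S. div_weight (2 * j) a)"
  proof (intro sum_mono)
    fix x assume "x \<in> ?S"
    then obtain n n' where x: "x = (n, n')" "a = n * n'" by (cases x) auto
    have "num_divs n \<le> num_divs a" "num_divs n' \<le> num_divs a"
      using assms by (auto simp: x intro!: num_divs_mono)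
    then have "real (num_divs n) ^ j * real (num_divs n') ^ j \<le> real (num_divs a) ^ j * real (num_divs a) ^ j"
      by (intro mult_mono power_mono) auto
    then show "div_weight j (fst x) * div_weight j (snd x) \<le> div_weight (2 * j) a"
      by (simp add: x real_sqrt_mult mult_2 power_add divide_right_mono)
  qed
  also have "\<dots> = real (card ?S) * div_weight (2 * j) a" by simp
  also have "\<dots> \<le> real (num_divs a) * div_weight (2 * j) a"
  proof -
    have "card ?S \<le> num_divs a"
      unfolding num_divs_def
      by (rule card_inj_on_le[of fst]) (use assms in \<open>auto simp: inj_on_def\<close>)
    then show ?thesis by (intro mult_right_mono) auto
  qed
  finally show ?thesis by simp
qed

text \<open>Each squaring of the kernel squares the range and turns the exponent \<open>j\<close>
  into \<open>2 * j + 1\<close>; starting from \<open>X\<close> and \<open>0\<close> this yields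
  \<open>X ^ (2 ^ i)\<close> and \<open>2 ^ i - 1\<close>.\<close>

lemma sq_kernel_le_ratio_kernel:
  assumes "finite D" "\<And>f. f \<in> D \<Longrightarrow> f > 0" "\<And>d e. K d e \<ge> 0"
    and "\<And>d e. d \<in> D \<Longrightarrow> e \<in> D \<Longrightarrow> K d e \<le> ratio_kernel X (div_weight 0) d e"
    and "d \<in> D" "e \<in> D"
  shows "sq_kernel D K i d e \<le> ratio_kernel (X ^ (2 ^ i)) (div_weight (2 ^ i - 1)) d e"
  using assms(5,6)
proof (induction i arbitrary: d e)
  case (Suc i)
  let ?c = "\<lambda>a. \<Sum>x | x \<in> {1..X ^ 2 ^ i} \<times> {1..X ^ 2 ^ i} \<and> fst x * snd x = a.
    div_weight (2 ^ i - 1) (fst x) * div_weight (2 ^ i - 1) (snd x)"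
  let ?R = "ratio_kernel (X ^ (2 ^ i)) (div_weight (2 ^ i - 1))"
  have conv: "0 \<le> ?c a \<and> ?c a \<le> div_weight (2 * (2 ^ i - 1) + 1) a" if "a \<in> {1..(X ^ 2 ^ i)\<^sup>2}" for a
    using that by (intro conjI div_weight_convolution_le sum_nonneg) auto
  have "sq_kernel D K (Suc i) d e \<le> (\<Sum>f\<in>D. ?R d f * ?R f e)"
    using Suc assms(3) by (auto intro!: sum_mono mult_mono sq_kernel_nonneg ratio_kernel_nonneg)
  also have "\<dots> \<le> ratio_kernel ((X ^ (2 ^ i))\<^sup>2) (div_weight (2 * (2 ^ i - 1) + 1)) d e"
    using assms(1,2) by (rule order_trans[OF ratio_kernel_compose ratio_kernel_mono[OF conv]]) auto
  also have "2 * (2 ^ i - 1) + 1 = (2 ^ Suc i - 1 :: nat)"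
    by (cases "2 ^ i :: nat") auto
  finally show ?case by (simp add: power_mult[symmetric] mult.commute)
qed (use assms in simp)


subsection \<open>A GCD sum\<close>

text \<open>The truncation costs at most \<open>1 / X\<close> per pair, and bounds the numerator and denominator of
  the reduced ratio \<open>d / e\<close> by \<open>X\<close>.\<close>

definition trunc_gcd_kernel :: "nat \<Rightarrow> nat \<Rightarrow> nat \<Rightarrow> real" where
  "trunc_gcd_kernel X d e = (if max d e \<le> X * gcd d e then real (gcd d e) / real (max d e) else 0)"

text \<open>If \<open>d / e = p / q\<close> in lowest terms, then
  \<open>gcd d e / max d e = 1 / max p q \<le> 1 / sqrt (p * q)\<close>, which is the single term
  \<open>n = q\<close>, \<open>m = p\<close> of the ratio kernel. The truncation puts
  \<open>p\<close> and \<open>q\<close> into its range.\<close>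

lemma trunc_gcd_kernel_le_ratio_kernel:
  assumes "d > 0" "e > 0"
  shows "trunc_gcd_kernel X d e \<le> ratio_kernel X (div_weight 0) d e"
proof (cases "max d e \<le> X * gcd d e")
  case True
  define g where "g = gcd d e"
  obtain p q where pq: "d = g * p" "e = g * q"
    unfolding g_def by (meson dvdE gcd_dvd1 gcd_dvd2)
  have pos: "g > 0" "p > 0" "q > 0" using assms pq by (auto intro!: Nat.gr0I)
  have "max p q * g \<le> X * g"
    using True[folded g_def] pq by (simp add: nat_mult_max_left mult.commute)
  then have X: "max p q \<le> X" using pos by simp
  have eq: "q * d = p * e" by (simp add: pq)
  have "sqrt q * sqrt p \<le> sqrt (max p q) * sqrt (max p q)"
    by (intro mult_mono) auto
  then have le: "sqrt q * sqrt p \<le> max p q" by simp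
  have "trunc_gcd_kernel X d e = 1 / max p q"
  proof -
    have "trunc_gcd_kernel X d e = real g / real (max d e)"
      using True by (simp add: trunc_gcd_kernel_def g_def)
    also have "max d e = g * max p q" by (simp add: pq nat_mult_max_right)
    finally show ?thesis using pos by simp
  qed
  also have "\<dots> \<le> 1 / (sqrt q * sqrt p)"
    using le pos by (intro divide_left_mono) auto
  also have "\<dots> = (if q * d = p * e then div_weight 0 q * div_weight 0 p else 0)"
    using eq by simp
  also have "\<dots> \<le> (\<Sum>m = 1..X. if q * d = m * e then div_weight 0 q * div_weight 0 m else 0)"
    using X pos by (intro member_le_sum) auto
  also have "\<dots> \<le> ratio_kernel X (div_weight 0) d e"
    unfolding ratio_kernel_def
    by (rule member_le_sum[where f = "\<lambda>n. \<Sum>m = 1..X. if n * d = m * e then div_weight 0 n * div_weight 0 m else 0"])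
      (use X pos in \<open>auto intro!: sum_nonneg\<close>)
  finally show ?thesis .
next
  case False
  then show ?thesis
    unfolding trunc_gcd_kernel_def by (simp only: if_False) (simp add: ratio_kernel_nonneg)
qed

text \<open>The sum of squares that bounds the ratio kernel is a moment of the divisor function. The
  resulting power of a logarithm is uniform in \<open>D\<close>.\<close>

lemma sq_kernel_trunc_gcd_le:
  assumes "finite D" "\<And>d. d \<in> D \<Longrightarrow> d > 0" "X \<ge> 1" "d \<in> D" "e \<in> D"
  shows "sq_kernel D (trunc_gcd_kernel X) i d e \<le> (1 + 2 ^ i * ln X) ^ (2 ^ (2 * (2 ^ i - 1)))"
proof -
  have "sq_kernel D (trunc_gcd_kernel X) i d e
      \<le> ratio_kernel (X ^ (2 ^ i)) (div_weight (2 ^ i - 1)) d e"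
    using assms
    by (intro sq_kernel_le_ratio_kernel trunc_gcd_kernel_le_ratio_kernel)
      (auto simp: trunc_gcd_kernel_def)
  also have "\<dots> \<le> (\<Sum>n = 1..X ^ 2 ^ i. (div_weight (2 ^ i - 1) n)\<^sup>2)"
    using assms by (intro ratio_kernel_le_sum_squares) auto
  also have "\<dots> = (\<Sum>n = 1..X ^ 2 ^ i. real (num_divs n) ^ (2 * (2 ^ i - 1)) / n)"
    by (intro sum.cong) (auto simp: power_divide power_mult[symmetric] mult.commute)
  also have "\<dots> \<le> (1 + ln (X ^ 2 ^ i)) ^ (2 ^ (2 * (2 ^ i - 1)))"
    using assms by (intro sum_num_divs_power_le) auto
  also have "ln (real (X ^ 2 ^ i)) = 2 ^ i * ln X"
    using assms by (simp add: ln_realpow)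
  finally show ?thesis .
qed

text \<open>Both \<open>1\<close> and \<open>ln x / A\<close> are at most
  \<open>x powr (1 / A)\<close>, and the \<open>A\<close>-th power of the latter is
  \<open>x\<close>. A linear bound suffices, since a high root is taken afterwards.\<close>

lemma polylog_le:
  fixes c :: real and A :: nat
  assumes "c \<ge> 0"
  obtains C where "C > 0" "\<And>x :: real. x \<ge> 1 \<Longrightarrow> (1 + c * ln x) ^ A \<le> C * x"
proof (cases "A = 0")
  case True
  then show ?thesis using that[of 1] by simp
next
  case False
  show ?thesis
  proof (rule that[of "(1 + c * A) ^ A"])
    fix x :: real assume x: "x \<ge> 1"
    have "ln x \<le> x powr (1 / A) / (1 / A)"
      using x False by (intro ln_powr_bound) auto
    then have "c * ln x \<le> c * A * x powr (1 / A)"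
      using assms by (auto dest: mult_left_mono[where c = c] simp: mult_ac)
    moreover have "1 \<le> x powr (1 / A)" using x by (simp add: ge_one_powr_ge_zero)
    ultimately have "1 + c * ln x \<le> (1 + c * A) * x powr (1 / A)"
      by (simp add: algebra_simps)
    then have "(1 + c * ln x) ^ A \<le> ((1 + c * A) * x powr (1 / A)) ^ A"
      using x assms by (intro power_mono) auto
    also have "\<dots> = (1 + c * A) ^ A * x"
      using x False by (simp add: power_mult_distrib powr_realpow[symmetric] powr_powr)
    finally show "(1 + c * ln x) ^ A \<le> (1 + c * A) ^ A * x" .
  qed (use assms in \<open>auto intro!: zero_less_power add_pos_nonneg\<close>)
qed

text \<open>With \<open>H = card D\<close>, the \<open>k\<close>-th power of the truncated sum is at
  most \<open>H ^ (k - 1)\<close> times \<open>H ^ 2\<close> entries of size \<open>C * H\<close>,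
  that is \<open>C * H ^ (k + 2)\<close>; the \<open>k\<close>-th root has exponent
  \<open>1 + 2 / k\<close>.\<close>

lemma gcd_max_sum_le:
  fixes \<eta> :: real
  assumes "\<eta> > 0"
  obtains C where "C > 0"
    "\<And>D :: nat set. finite D \<Longrightarrow> 0 \<notin> D \<Longrightarrow>
       (\<Sum>d\<in>D. \<Sum>e\<in>D. real (gcd d e) / real (max d e)) \<le> C * real (card D) powr (1 + \<eta>)"
proof -
  \<comment> \<open>The exponent \<open>k\<close> is a power of two because the kernel is squared
    repeatedly; it is taken so large that \<open>2 / k \<le> \<eta>\<close>.\<close>
  obtain i where i: "2 / \<eta> < 2 ^ i"
    using real_arch_pow[of 2 "2 / \<eta>"] by auto
  define k :: nat where "k = 2 ^ i"
  have k: "k > 0" "2 / k \<le> \<eta>"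
    using i assms by (auto simp: k_def field_simps)
  obtain C where C: "C > 0" "\<And>x :: real. x \<ge> 1 \<Longrightarrow> (1 + 2 ^ i * ln x) ^ (2 ^ (2 * (2 ^ i - 1))) \<le> C * x"
    using polylog_le[of "2 ^ i" "2 ^ (2 * (2 ^ i - 1))"] by auto
  show ?thesis
  proof (rule that[of "1 + C powr (1 / k)"])
    fix D :: "nat set" assume D: "finite D" "0 \<notin> D"
    show "(\<Sum>d\<in>D. \<Sum>e\<in>D. real (gcd d e) / real (max d e)) \<le> (1 + C powr (1 / k)) * real (card D) powr (1 + \<eta>)"
    proof (cases "D = {}")
      case False
      define H where "H = card D"
      have H: "H \<ge> 1" using D False by (simp add: H_def Suc_le_eq card_gt_0_iff)
      \<comment> \<open>Truncating at \<open>H\<close> loses at most \<open>1 / H\<close> for each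
        of the \<open>H ^ 2\<close> pairs, hence at most \<open>H\<close> in total.\<close>
      let ?K = "trunc_gcd_kernel H"
      let ?W = "\<Sum>d\<in>D. \<Sum>e\<in>D. ?K d e"
      have W0: "?W \<ge> 0" by (intro sum_nonneg) (simp add: trunc_gcd_kernel_def)
      have pos: "d > 0" if "d \<in> D" for d using that D by (auto intro: Nat.gr0I)
      have "?W ^ k \<le> real H ^ (k - 1) * (\<Sum>d\<in>D. \<Sum>e\<in>D. sq_kernel D ?K i d e)"
        unfolding k_def H_def
        by (rule sum_kernel_power_le) (auto simp: trunc_gcd_kernel_def gcd.commute max.commute D)
      also have "\<dots> \<le> real H ^ (k - 1) * (\<Sum>d\<in>D. \<Sum>e\<in>D. C * H)"
      proof (intro mult_left_mono sum_mono)
        fix d e assume "d \<in> D" "e \<in> D"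
        then have "sq_kernel D ?K i d e \<le> (1 + 2 ^ i * ln (real H)) ^ (2 ^ (2 * (2 ^ i - 1)))"
          using D pos H by (intro sq_kernel_trunc_gcd_le)
        also have "\<dots> \<le> C * H" using H by (intro C(2)) simp
        finally show "sq_kernel D ?K i d e \<le> C * H" .
      qed simp
      also have "\<dots> = C * real H ^ (k + 2)"
        using k by (cases k) (simp_all add: H_def)
      finally have "(?W ^ k) powr (1 / k) \<le> (C * real H ^ (k + 2)) powr (1 / k)"
        using W0 by (intro powr_mono2) auto
      then have "?W \<le> (C * real H ^ (k + 2)) powr (1 / k)"
        using W0 k by (cases "?W = 0") (simp_all add: powr_realpow[symmetric] powr_powr)
      also have "\<dots> = C powr (1 / k) * real H powr (1 + 2 / k)"
      proof -
        have "real H ^ (k + 2) = real H powr real (k + 2)"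
          using H by (intro powr_realpow[symmetric]) simp
        moreover have "real (k + 2) * (1 / k) = 1 + 2 / k"
          using k(1) by (simp add: field_simps)
        ultimately show ?thesis
          using C(1) by (simp only: powr_mult powr_powr)
      qed
      also have "\<dots> \<le> C powr (1 / k) * real H powr (1 + \<eta>)"
        using H k(2) by (intro mult_left_mono powr_mono) simp_all
      finally have W: "?W \<le> C powr (1 / k) * real H powr (1 + \<eta>)" .
      have "(\<Sum>d\<in>D. \<Sum>e\<in>D. real (gcd d e) / real (max d e)) \<le> (\<Sum>d\<in>D. \<Sum>e\<in>D. ?K d e + 1 / H)"
      proof (intro sum_mono)
        fix d e assume de: "d \<in> D" "e \<in> D"
        show "real (gcd d e) / real (max d e) \<le> ?K d e + 1 / H"
        proof (cases "max d e \<le> H * gcd d e")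
          case False
          then have "real (H * gcd d e) \<le> max d e" by linarith
          then show ?thesis
            using False H pos[OF de(1)] unfolding trunc_gcd_kernel_def
            by (simp only: if_False) (simp add: divide_le_eq le_divide_eq field_simps)
        qed (simp add: trunc_gcd_kernel_def)
      qed
      also have "\<dots> = ?W + H"
        using H by (simp add: sum.distrib H_def)
      also have "real H \<le> real H powr (1 + \<eta>)"
        using H assms powr_mono[of 1 "1 + \<eta>" "real H"] by simp
      finally show ?thesis
        using W by (simp add: H_def algebra_simps)
    qed simp
  qed (use C in \<open>auto intro: add_pos_nonneg\<close>)
qed

subsection \<open>Multiples close to an integer\<close>

definition near_int :: "real \<Rightarrow> real set" where
  "near_int \<delta> = {x. dist_int x \<le> \<delta>}"

lemma mem_near_int_iff: "x \<in> near_int \<delta> \<longleftrightarrow> (\<exists>k::int. \<bar>x - k\<bar> \<le> \<delta>)"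
  unfolding near_int_def using dist_int_le[of x] dist_int_attained[of x]
  by (auto intro: order_trans)

lemma near_int_add_int: "x + of_int k \<in> near_int \<delta> \<longleftrightarrow> x \<in> near_int \<delta>"
proof
  assume "x + of_int k \<in> near_int \<delta>"
  then obtain l :: int where "\<bar>x + of_int k - l\<bar> \<le> \<delta>" by (auto simp: mem_near_int_iff)
  then show "x \<in> near_int \<delta>"
    by (auto simp: mem_near_int_iff intro!: exI[of _ "l - k"])
next
  assume "x \<in> near_int \<delta>"
  then obtain l :: int where "\<bar>x - l\<bar> \<le> \<delta>" by (auto simp: mem_near_int_iff)
  then show "x + of_int k \<in> near_int \<delta>"
    by (auto simp: mem_near_int_iff intro!: exI[of _ "l + k"])
qed

lemma near_int_add_nat: "x + real k \<in> near_int \<delta> \<longleftrightarrow> x \<in> near_int \<delta>"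
  using near_int_add_int[of x "int k"] by simp

lemma near_int_borel [measurable]: "near_int \<delta> \<in> sets borel"
proof -
  have "near_int \<delta> = (\<Union>k::int. {x. \<bar>x - k\<bar> \<le> \<delta>})"
    by (auto simp: mem_near_int_iff)
  also have "\<dots> \<in> sets borel" by measurable
  finally show ?thesis .
qed

text \<open>The shifts counted correspond to the integers in a closed interval of length
  \<open>2 * \<delta> * M\<close>, and the number of these differs from the length by at most
  1.\<close>

lemma card_near_int_shifts:
  fixes x \<delta> :: real and M :: nat
  assumes "M > 0" "0 \<le> \<delta>" "2 * \<delta> < 1"
  shows "\<bar>real (card {j. j < M \<and> x + j / M \<in> near_int \<delta>}) - 2 * \<delta> * M\<bar> \<le> 1"
proof -
  define lo hi where "lo = - M * x - \<delta> * M" and "hi = - M * x + \<delta> * M"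
  let ?I = "{\<lceil>lo\<rceil>..\<lfloor>hi\<rfloor>}" and ?S = "{j. j < M \<and> x + j / M \<in> near_int \<delta>}"
  have I: "n \<in> ?I \<longleftrightarrow> \<bar>x + n / M\<bar> \<le> \<delta>" for n :: int
  proof -
    have "n \<in> ?I \<longleftrightarrow> \<bar>M * x + n\<bar> \<le> \<delta> * M"
      by (auto simp: lo_def hi_def ceiling_le_iff le_floor_iff abs_le_iff)
    also have "M * x + n = (x + n / M) * M" using assms by (simp add: field_simps)
    also have "\<bar>(x + n / M) * M\<bar> = \<bar>x + n / M\<bar> * M" by (simp add: abs_mult)
    finally show ?thesis using assms by simp
  qed
  \<comment> \<open>If \<open>x + j / M\<close> is within \<open>\<delta>\<close> of the integer
    \<open>k\<close>, then \<open>n = j - k * M\<close> lies in \<open>?I\<close>, and reduction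
    modulo \<open>M\<close> recovers \<open>j\<close>. It is injective on \<open>?I\<close> because
    the interval is shorter than \<open>M\<close>.\<close>
  have "bij_betw (\<lambda>n. nat (n mod int M)) ?I ?S"
  proof (rule bij_betw_imageI)
    show "inj_on (\<lambda>n. nat (n mod int M)) ?I"
    proof (rule inj_onI)
      fix n n' assume n: "n \<in> ?I" "n' \<in> ?I" and "nat (n mod int M) = nat (n' mod int M)"
      then have "n mod int M = n' mod int M" using assms by (simp add: eq_nat_nat_iff)
      then have dvd: "int M dvd n - n'" by (simp add: mod_eq_dvd_iff)
      have "real_of_int (n - n') \<le> hi - lo" "real_of_int (n' - n) \<le> hi - lo"
        using n by (auto simp: ceiling_le_iff le_floor_iff)
      moreover have "hi - lo < M"
        using mult_strict_right_mono[OF assms(3), of M] assms(1) by (simp add: hi_def lo_def)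
      ultimately have "\<bar>n - n'\<bar> < int M" by linarith
      then show "n = n'" using dvd zdvd_not_zless[of "n - n'" "int M"] zdvd_not_zless[of "n' - n" "int M"]
        by (metis abs_of_nonneg dvd_imp_le_int eq_iff_diff_eq_0 abs_of_nat not_le)
    qed
    show "(\<lambda>n. nat (n mod int M)) ` ?I = ?S"
    proof (intro equalityI subsetI)
      fix j assume "j \<in> (\<lambda>n. nat (n mod int M)) ` ?I"
      then obtain n where n: "n \<in> ?I" "j = nat (n mod int M)" by auto
      have "int j = n - int M * (n div int M)" using n assms by (simp add: minus_mult_div_eq_mod)
      then have "real j = n - real M * (n div int M)"
        by (metis of_int_diff of_int_mult of_int_of_nat_eq)
      then have "x + j / M = (x + n / M) + of_int (- (n div int M))"
        using assms by (simp add: field_simps)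
      moreover have "x + n / M \<in> near_int \<delta>"
        using n(1) unfolding I by (auto simp: mem_near_int_iff intro!: exI[of _ 0])
      moreover have "j < M" using n assms by (simp add: nat_less_iff)
      ultimately show "j \<in> ?S" by (simp only: near_int_add_int mem_Collect_eq)
    next
      fix j assume "j \<in> ?S"
      then obtain k :: int where k: "j < M" "\<bar>x + j / M - k\<bar> \<le> \<delta>"
        by (auto simp: mem_near_int_iff)
      define n where "n = int j - k * int M"
      have "x + n / M = x + j / M - k" using assms by (simp add: n_def field_simps)
      then have "n \<in> ?I" unfolding I using k by simp
      moreover have "nat (n mod int M) = j"
        using k by (simp add: n_def mod_diff_eq[symmetric] zmod_int[symmetric])
      ultimately show "j \<in> (\<lambda>n. nat (n mod int M)) ` ?I" by (intro image_eqI[of _ _ n]) auto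
    qed
  qed
  then have "card ?S = card ?I" using bij_betw_same_card by force
  then have "int (card ?S) = max 0 (\<lfloor>hi\<rfloor> - \<lceil>lo\<rceil> + 1)" by simp
  moreover have "hi - lo = 2 * \<delta> * M" by (simp add: hi_def lo_def)
  moreover have "0 \<le> 2 * \<delta> * M" using assms by simp
  ultimately show ?thesis by linarith
qed

section \<open>Averages over translates of the unit interval\<close>

abbreviation unit_lborel :: "real measure" where
  "unit_lborel \<equiv> restrict_space lborel {0..<1}"

lemma emeasure_unit_lborel: "emeasure unit_lborel {0..<1} = 1"
  by (simp add: emeasure_restrict_space)

interpretation unit_lborel: finite_measure unit_lborel
  by (rule finite_measureI) (simp add: emeasure_unit_lborel)

lemma integrable_unit_lborel:
  fixes g :: "real \<Rightarrow> real"
  assumes [measurable]: "g \<in> borel_measurable borel" and "\<And>x. \<bar>g x\<bar> \<le> B"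
  shows "integrable unit_lborel g"
  by (rule unit_lborel.integrable_const_bound[where B = B])
    (use assms in \<open>auto intro!: measurable_restrict_space1\<close>)

text \<open>The translated window \<open>{s..<1 + s}\<close> is cut at 1, and periodicity moves its
  second piece back to \<open>{0..<s}\<close>. Half-open intervals make the pieces fit without
  overlap.\<close>

lemma integral_unit_lborel_shift:
  fixes g :: "real \<Rightarrow> real"
  assumes [measurable]: "g \<in> borel_measurable borel"
    and bd: "\<And>x. \<bar>g x\<bar> \<le> B" and per: "\<And>x. g (x + 1) = g x" and s: "0 \<le> s" "s \<le> 1"
  shows "(\<integral>x. g (x + s) \<partial>unit_lborel) = (\<integral>x. g x \<partial>unit_lborel)"
proof -
  let ?J = "\<lambda>a b. \<integral>x. indicator {a..<b} x * g x \<partial>lborel"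
  have int: "integrable lborel (\<lambda>x. indicator {a..<b} x * g x)" for a b
  proof (rule integrableI_bounded_set[where A = "{a..<b}" and B = B])
    show "emeasure lborel {a..<b} < \<infinity>" by (cases "a \<le> b") auto
  qed (use bd in \<open>auto simp: indicator_def\<close>)
  have combine: "?J a b + ?J b c = ?J a c" if "a \<le> b" "b \<le> c" for a b c
    using that by (subst Bochner_Integration.integral_add[symmetric, OF int int])
      (auto intro!: Bochner_Integration.integral_cong simp: indicator_def)
  have shift: "(\<integral>x. indicator {a..<b} x * g (x + t) \<partial>lborel) = ?J (a + t) (b + t)" for a b t
    by (subst lborel_integral_real_affine[of 1 _ t])
      (auto intro!: Bochner_Integration.integral_cong simp: indicator_def add.commute)
  have "(\<integral>x. g (x + s) \<partial>unit_lborel) = ?J s (1 + s)"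
    using shift[of 0 1 s] by (simp add: integral_restrict_space)
  also have "\<dots> = ?J s 1 + ?J 1 (1 + s)" using s by (simp add: combine)
  also have "?J 1 (1 + s) = ?J 0 s" using shift[of 0 s 1] by (simp add: per add.commute)
  also have "?J s 1 + ?J 0 s = ?J 0 1" using combine[of 0 s 1] s by simp
  also have "\<dots> = (\<integral>x. g x \<partial>unit_lborel)" by (simp add: integral_restrict_space)
  finally show ?thesis .
qed

lemma integral_unit_lborel_average:
  fixes g :: "real \<Rightarrow> real"
  assumes [measurable]: "g \<in> borel_measurable borel"
    and bd: "\<And>x. \<bar>g x\<bar> \<le> B" and per: "\<And>x. g (x + 1) = g x"
    and s: "\<And>j. j < M \<Longrightarrow> 0 \<le> s j \<and> s j \<le> 1"
  shows "real M * (\<integral>x. g x \<partial>unit_lborel) = (\<integral>x. (\<Sum>j<M. g (x + s j)) \<partial>unit_lborel)"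
proof -
  have "(\<integral>x. (\<Sum>j<M. g (x + s j)) \<partial>unit_lborel) = (\<Sum>j<M. \<integral>x. g (x + s j) \<partial>unit_lborel)"
    using bd by (intro Bochner_Integration.integral_sum integrable_unit_lborel[where B = B]) auto
  also have "\<dots> = (\<Sum>j<M. \<integral>x. g x \<partial>unit_lborel)"
    using s by (intro sum.cong integral_unit_lborel_shift[where B = B] assms) auto
  finally show ?thesis by simp
qed

text \<open>Averaging over \<open>M\<close> shifts replaces the indicator by a count that is within
  1 of \<open>2 * \<delta> * M\<close>. Thus \<open>M\<close> times the error is at most 1 for every
  \<open>M\<close>, and the error vanishes.\<close>

lemma integral_near_int:
  fixes d :: nat
  assumes "d > 0" "0 \<le> \<delta>" "2 * \<delta> < 1"
  shows "(\<integral>x. indicator (near_int \<delta>) (d * x) \<partial>unit_lborel) = 2 * \<delta>"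
proof -
  let ?g = "\<lambda>x. indicat_real (near_int \<delta>) (real d * x)"
  let ?\<mu> = "\<integral>x. ?g x \<partial>unit_lborel"
  have bound: "real M * \<bar>?\<mu> - 2 * \<delta>\<bar> \<le> 1" if "M > 0" for M :: nat
  proof -
    \<comment> \<open>A shift of \<open>x\<close> by \<open>j / (d * M)\<close> moves
      \<open>d * x\<close> by \<open>j / M\<close>.\<close>
    let ?h = "\<lambda>x. \<Sum>j<M. ?g (x + j / (d * M))"
    have h: "?h x = card {j. j < M \<and> d * x + j / M \<in> near_int \<delta>}" for x :: real
    proof -
      have "?h x = (\<Sum>j<M. indicat_real {j. d * x + j / M \<in> near_int \<delta>} j)"
        using assms by (simp add: distrib_left indicator_def)
      also have "\<dots> = card {j. j < M \<and> d * x + j / M \<in> near_int \<delta>}"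
        by (simp add: indicator_def Collect_conj_eq lessThan_def)
      finally show ?thesis .
    qed
    have hb: "\<bar>?h x - 2 * \<delta> * M\<bar> \<le> 1" for x :: real
      using card_near_int_shifts[OF that assms(2,3), of "d * x"] h[of x] by linarith
    have int_h: "integrable unit_lborel ?h"
      by (intro Bochner_Integration.integrable_sum integrable_unit_lborel[where B = 1]) auto
    have "real M * (?\<mu> - 2 * \<delta>) = (\<integral>x. ?h x \<partial>unit_lborel) - (\<integral>x. 2 * \<delta> * M \<partial>unit_lborel)"
    proof -
      have "real M * ?\<mu> = (\<integral>x. ?h x \<partial>unit_lborel)"
      proof (rule integral_unit_lborel_average[where B = 1])
        show "?g (x + 1) = ?g x" for x
          using near_int_add_nat[of "d * x" d] by (simp add: indicator_def distrib_left)
        show "0 \<le> j / (d * M) \<and> j / (d * M) \<le> 1" if "j < M" for j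
        proof -
          have "M \<le> d * M" using assms(1) by simp
          then have "real j \<le> real (d * M)" using that by (intro of_nat_mono) linarith
          then show ?thesis using assms(1) that by (simp add: divide_le_eq_1 del: of_nat_mult)
        qed
      qed auto
      then show ?thesis
        by (simp add: measure_def emeasure_unit_lborel algebra_simps)
    qed
    also have "\<dots> = (\<integral>x. ?h x - 2 * \<delta> * M \<partial>unit_lborel)"
      using int_h by (intro Bochner_Integration.integral_diff[symmetric]) auto
    also have "\<bar>\<dots>\<bar> \<le> (\<integral>x. 1 \<partial>unit_lborel)"
      using int_h hb by (intro order_trans[OF integral_abs_bound] integral_mono) auto
    finally show ?thesis by (simp add: abs_mult measure_def emeasure_unit_lborel)
  qed
  show ?thesis
  proof (rule ccontr)
    assume "?\<mu> \<noteq> 2 * \<delta>"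
    then have pos: "\<bar>?\<mu> - 2 * \<delta>\<bar> > 0" by simp
    then obtain M where "1 < real M * \<bar>?\<mu> - 2 * \<delta>\<bar>"
      using reals_Archimedean3 by blast
    then show False using bound[of M] by (cases "M = 0") auto
  qed
qed

text \<open>Multiplication by \<open>p\<close> permutes the residues modulo \<open>q\<close>, which
  reduces the count to equally spaced shifts.\<close>

lemma card_near_int_multiples_le:
  fixes p q :: nat
  assumes "coprime p q" "q > 0" "0 \<le> \<delta>" "2 * \<delta> < 1"
  shows "real (card {j. j < q \<and> y + real (j * p) / q \<in> near_int \<delta>}) \<le> 2 * \<delta> * q + 1"
proof -
  have "card {j. j < q \<and> y + real (j * p) / q \<in> near_int \<delta>}
      \<le> card {i. i < q \<and> y + i / q \<in> near_int \<delta>}"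
  proof (rule card_inj_on_le[of "\<lambda>j. j * p mod q"])
    have aux: "j \<le> i" if "i < q" "j < q" "i * p mod q = j * p mod q" for i j
    proof (rule ccontr)
      assume "\<not> j \<le> i"
      then have "q dvd j * p - i * p"
        using that(3) by (subst mod_eq_dvd_iff_nat[symmetric]) auto
      then have "q dvd (j - i) * p" by (simp add: diff_mult_distrib)
      then have "q dvd j - i" using assms(1) by (simp add: coprime_dvd_mult_left_iff coprime_commute)
      then show False using \<open>\<not> j \<le> i\<close> that dvd_imp_le[of q "j - i"] by auto
    qed
    show "inj_on (\<lambda>j. j * p mod q) {j. j < q \<and> y + real (j * p) / q \<in> near_int \<delta>}"
    proof (rule inj_onI)
      fix i j assume "i \<in> {j. j < q \<and> y + real (j * p) / q \<in> near_int \<delta>}"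
        "j \<in> {j. j < q \<and> y + real (j * p) / q \<in> near_int \<delta>}" "i * p mod q = j * p mod q"
      then show "i = j" using aux[of i j] aux[of j i] by auto
    qed
    show "(\<lambda>j. j * p mod q) ` {j. j < q \<and> y + real (j * p) / q \<in> near_int \<delta>}
        \<subseteq> {i. i < q \<and> y + i / q \<in> near_int \<delta>}"
    proof clarify
      fix j assume j: "y + real (j * p) / q \<in> near_int \<delta>"
      have "real (j * p) = real (j * p mod q) + real q * real (j * p div q)"
        by (metis mod_mult_div_eq of_nat_add of_nat_mult)
      then have "y + real (j * p) / q = (y + real (j * p mod q) / q) + real (j * p div q)"
        using assms(2) by (simp add: field_simps)
      then show "j * p mod q < q \<and> y + real (j * p mod q) / q \<in> near_int \<delta>"
        using j assms(2) by (simp only: near_int_add_nat) simp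
    qed
  qed auto
  moreover have "real (card {i. i < q \<and> y + i / q \<in> near_int \<delta>}) \<le> 2 * \<delta> * q + 1"
    using card_near_int_shifts[OF assms(2-4), of y] by linarith
  ultimately show ?thesis by linarith
qed

text \<open>Shifting \<open>x\<close> by \<open>j / e\<close> fixes \<open>e x\<close> modulo 1, whereas \<open>d x\<close> moves through all multiples of
  \<open>gcd d e / e\<close>. Averaging over these shifts replaces the first factor by a count.\<close>

lemma integral_near_int_mult_le:
  fixes d e :: nat
  assumes "d > 0" "e > 0" "0 \<le> \<delta>" "2 * \<delta> < 1"
  shows "(\<integral>x. indicator (near_int \<delta>) (d * x) * indicator (near_int \<delta>) (e * x) \<partial>unit_lborel)
     \<le> 2 * \<delta> * (2 * \<delta> + gcd d e / e)"
proof -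
  let ?f = "\<lambda>d x. indicat_real (near_int \<delta>) (real d * x)"
  obtain p q where pq: "d = gcd d e * p" "e = gcd d e * q" "coprime p q"
    using gcd_coprime_exists[of d e] assms by (auto simp: mult.commute)
  define g where "g = gcd d e"
  note pq = pq[folded g_def]
  have pos: "g > 0" "q > 0" using pq assms by (auto intro!: Nat.gr0I)
  let ?s = "\<lambda>j. real j / e"
  have "real q * (\<integral>x. ?f d x * ?f e x \<partial>unit_lborel)
      = (\<integral>x. (\<Sum>j<q. ?f d (x + ?s j) * ?f e (x + ?s j)) \<partial>unit_lborel)"
  proof (rule integral_unit_lborel_average[where B = 1])
    show "?f d (x + 1) * ?f e (x + 1) = ?f d x * ?f e x" for x
      using near_int_add_nat[of "d * x" d] near_int_add_nat[of "e * x" e]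
      by (simp add: indicator_def distrib_left)
    show "0 \<le> ?s j \<and> ?s j \<le> 1" if "j < q" for j
    proof -
      have "q \<le> e" using pq(2) pos by simp
      then show ?thesis using that assms(2) by auto
    qed
    show "\<bar>?f d x * ?f e x\<bar> \<le> 1" for x by (simp add: indicator_def)
  qed simp
  also have "\<dots> \<le> (\<integral>x. (2 * \<delta> * q + 1) * ?f e x \<partial>unit_lborel)"
  proof (rule integral_mono)
    show "integrable unit_lborel (\<lambda>x. \<Sum>j<q. ?f d (x + ?s j) * ?f e (x + ?s j))"
      by (intro Bochner_Integration.integrable_sum integrable_unit_lborel[where B = 1])
        (auto simp: indicator_def)
    show "integrable unit_lborel (\<lambda>x. (2 * \<delta> * q + 1) * ?f e x)"
      by (intro integrable_mult_right integrable_unit_lborel[where B = 1]) auto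
    fix x
    have "?f e (x + ?s j) = ?f e x" for j
      using near_int_add_nat[of "e * x" j] assms(2) by (simp add: indicator_def distrib_left)
    moreover have "?f d (x + ?s j) = indicator (near_int \<delta>) (d * x + real (j * p) / q)" for j
    proof -
      have "real d * ?s j = real (j * p) / q"
        using pos by (simp add: pq(1,2))
      then show ?thesis by (simp add: distrib_left)
    qed
    ultimately have "(\<Sum>j<q. ?f d (x + ?s j) * ?f e (x + ?s j))
        = (\<Sum>j<q. indicat_real {j. d * x + real (j * p) / q \<in> near_int \<delta>} j) * ?f e x"
      by (simp add: sum_distrib_right indicator_def)
    also have "(\<Sum>j<q. indicat_real {j. d * x + real (j * p) / q \<in> near_int \<delta>} j)
        = card {j. j < q \<and> d * x + real (j * p) / q \<in> near_int \<delta>}"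
      by (simp add: indicator_def Collect_conj_eq lessThan_def)
    also have "\<dots> * ?f e x \<le> (2 * \<delta> * q + 1) * ?f e x"
      using card_near_int_multiples_le[OF pq(3) pos(2) assms(3,4)] by (intro mult_right_mono) auto
    finally show "(\<Sum>j<q. ?f d (x + ?s j) * ?f e (x + ?s j)) \<le> (2 * \<delta> * q + 1) * ?f e x" .
  qed
  also have "\<dots> = (2 * \<delta> * q + 1) * (2 * \<delta>)"
    using integral_near_int[OF assms(2-4)] by simp
  also have "\<dots> = real q * (2 * \<delta> * (2 * \<delta> + gcd d e / e))"
  proof -
    have "gcd d e / e = 1 / q" unfolding g_def[symmetric] using pq(2) pos by simp
    then show ?thesis using pos by (simp add: field_simps)
  qed
  finally show ?thesis using pos by simp
qed

text \<open>Chebyshev's inequality for the number \<open>?S x\<close> of \<open>d\<close> with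
  \<open>d * x\<close> near an integer: its mean is \<open>c\<close>, and it vanishes on the
  exceptional set, where the squared deviation is therefore \<open>c\<^sup>2\<close>.\<close>

lemma measure_far_from_int_le:
  fixes D :: "nat set"
  assumes "finite D" "0 \<notin> D" "D \<noteq> {}" "0 < \<delta>" "2 * \<delta> < 1"
  shows "measure unit_lborel {x \<in> {0..<1}. \<forall>d\<in>D. d * x \<notin> near_int \<delta>}
    \<le> (\<Sum>d\<in>D. \<Sum>e\<in>D. real (gcd d e) / real (max d e)) / (2 * \<delta> * (real (card D))\<^sup>2)"
proof -
  let ?f = "\<lambda>d x. indicat_real (near_int \<delta>) (real d * x)"
  let ?S = "\<lambda>x. \<Sum>d\<in>D. ?f d x"
  let ?bad = "{x \<in> {0..<1}. \<forall>d\<in>D. d * x \<notin> near_int \<delta>}"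
  define G where "G = (\<Sum>d\<in>D. \<Sum>e\<in>D. real (gcd d e) / real (max d e))"
  define c where "c = 2 * \<delta> * card D"
  have H: "card D > 0" using assms by (simp add: card_gt_0_iff)
  have c: "c > 0" using H assms by (simp add: c_def)
  have pos: "d > 0" if "d \<in> D" for d using that assms(2) by (auto intro: Nat.gr0I)
  have int1: "integrable unit_lborel (?f d)" for d
    by (rule integrable_unit_lborel[where B = 1]) auto
  have int2: "integrable unit_lborel (\<lambda>x. ?f d x * ?f e x)" for d e
    by (rule integrable_unit_lborel[where B = 1]) (auto simp: indicator_def)
  \<comment> \<open>The overlap bound is not symmetric in \<open>d\<close> and \<open>e\<close>;
    choosing the larger one as denominator gives the stronger estimate.\<close>
  have pair: "(\<integral>x. ?f d x * ?f e x \<partial>unit_lborel) \<le> 4 * \<delta>\<^sup>2 + 2 * \<delta> * (real (gcd d e) / real (max d e))"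
    if "d \<in> D" "e \<in> D" for d e
  proof (cases "d \<le> e")
    case True
    then show ?thesis using integral_near_int_mult_le[of d e \<delta>] pos that assms
      by (simp add: max_def power2_eq_square algebra_simps)
  next
    case False
    then show ?thesis using integral_near_int_mult_le[of e d \<delta>] pos that assms
      by (simp add: max_def power2_eq_square algebra_simps gcd.commute)
  qed
  have bad: "?bad \<in> sets unit_lborel"
    using assms(1) by (intro sets_restrict_space_iff[THEN iffD2]) auto
  have "c\<^sup>2 * measure unit_lborel ?bad = (\<integral>x. c\<^sup>2 * indicator ?bad x \<partial>unit_lborel)"
  proof -
    have "?bad \<inter> space unit_lborel = ?bad" by auto
    then show ?thesis using bad by (simp only: integral_mult_right_zero Bochner_Integration.integral_indicator)
  qed
  \<comment> \<open>The integrand is \<open>(?S x - c)\<^sup>2\<close>, expanded so that it can be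
    integrated term by term.\<close>
  also have "\<dots> \<le> (\<integral>x. (\<Sum>d\<in>D. \<Sum>e\<in>D. ?f d x * ?f e x) - 2 * c * ?S x + c\<^sup>2 \<partial>unit_lborel)"
  proof (rule integral_mono)
    fix x
    have "(\<Sum>d\<in>D. \<Sum>e\<in>D. ?f d x * ?f e x) - 2 * c * ?S x + c\<^sup>2 = (?S x - c)\<^sup>2"
      by (simp add: power2_eq_square sum_product[symmetric] algebra_simps)
    moreover have "?S x = 0" if "x \<in> ?bad"
      using that by (intro sum.neutral) (auto simp: indicator_def)
    ultimately show "c\<^sup>2 * indicator ?bad x \<le> (\<Sum>d\<in>D. \<Sum>e\<in>D. ?f d x * ?f e x) - 2 * c * ?S x + c\<^sup>2"
      by (cases "x \<in> ?bad") simp_all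
  next
    show "integrable unit_lborel (\<lambda>x. c\<^sup>2 * indicator ?bad x)"
      using bad by (intro integrable_mult_right) (simp add: unit_lborel.emeasure_finite less_top[symmetric])
  qed (intro Bochner_Integration.integrable_add Bochner_Integration.integrable_diff
      Bochner_Integration.integrable_sum int2 integrable_mult_right int1 unit_lborel.integrable_const)
  also have "\<dots> = (\<Sum>d\<in>D. \<Sum>e\<in>D. \<integral>x. ?f d x * ?f e x \<partial>unit_lborel)
      - 2 * c * (\<Sum>d\<in>D. \<integral>x. ?f d x \<partial>unit_lborel) + c\<^sup>2"
    by (simp add: int1 int2 Bochner_Integration.integral_sum measure_def emeasure_unit_lborel)
  also have "(\<Sum>d\<in>D. \<integral>x. ?f d x \<partial>unit_lborel) = c"
    using assms pos by (simp add: integral_near_int c_def)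
  also have "(\<Sum>d\<in>D. \<Sum>e\<in>D. \<integral>x. ?f d x * ?f e x \<partial>unit_lborel)
      \<le> (\<Sum>d\<in>D. \<Sum>e\<in>D. 4 * \<delta>\<^sup>2 + 2 * \<delta> * (real (gcd d e) / real (max d e)))"
    by (intro sum_mono pair)
  also have "\<dots> = c\<^sup>2 + 2 * \<delta> * G"
    unfolding sum.distrib G_def by (simp add: sum_distrib_left c_def power2_eq_square)
  finally have "c\<^sup>2 * measure unit_lborel ?bad \<le> 2 * \<delta> * G"
    by (simp add: power2_eq_square)
  then have "measure unit_lborel ?bad \<le> 2 * \<delta> * G / c\<^sup>2"
    using c by (simp add: field_simps)
  also have "\<dots> = G / (2 * \<delta> * (real (card D))\<^sup>2)"
    using assms by (simp add: c_def power2_eq_square)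
  finally show ?thesis by (simp add: G_def)
qed

text \<open>One constant serves all \<open>D\<close> and \<open>\<delta>\<close>, as summing over
  dyadic blocks requires.\<close>

lemma measure_far_from_int_powr_le:
  fixes \<eta> :: real
  assumes "\<eta> > 0"
  obtains C where "C > 0"
    "\<And>D \<delta>. finite D \<Longrightarrow> 0 \<notin> D \<Longrightarrow> D \<noteq> {} \<Longrightarrow> 0 < \<delta> \<Longrightarrow> 2 * \<delta> < 1 \<Longrightarrow>
       measure unit_lborel {x \<in> {0..<1}. \<forall>d\<in>D. real d * x \<notin> near_int \<delta>}
         \<le> C * real (card D) powr (\<eta> - 1) / \<delta>"
proof -
  obtain C where C: "C > 0"
    "\<And>D :: nat set. finite D \<Longrightarrow> 0 \<notin> D \<Longrightarrow>
       (\<Sum>d\<in>D. \<Sum>e\<in>D. real (gcd d e) / real (max d e)) \<le> C * real (card D) powr (1 + \<eta>)"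
    using gcd_max_sum_le[OF assms] by blast
  show ?thesis
  proof (rule that[OF C(1)])
    fix D :: "nat set" and \<delta> :: real
    assume D: "finite D" "0 \<notin> D" "D \<noteq> {}" and \<delta>: "0 < \<delta>" "2 * \<delta> < 1"
    define H where "H = real (card D)"
    have H: "H > 0" using D by (simp add: H_def card_gt_0_iff)
    have "measure unit_lborel {x \<in> {0..<1}. \<forall>d\<in>D. real d * x \<notin> near_int \<delta>}
        \<le> (\<Sum>d\<in>D. \<Sum>e\<in>D. real (gcd d e) / real (max d e)) / (2 * \<delta> * H\<^sup>2)"
      unfolding H_def by (rule measure_far_from_int_le[OF D \<delta>])
    also have "\<dots> \<le> C * H powr (1 + \<eta>) / (2 * \<delta> * H\<^sup>2)"
      using C(2)[OF D(1,2)] \<delta> unfolding H_def by (intro divide_right_mono) auto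
    also have "\<dots> = C * H powr (\<eta> - 1) / \<delta> / 2"
    proof -
      have "H powr (1 + \<eta>) = H powr (\<eta> - 1) * H powr 2" by (simp flip: powr_add)
      also have "H powr 2 = H\<^sup>2" using H by (simp add: powr_numeral)
      finally show ?thesis using H \<delta> by simp
    qed
    also have "\<dots> \<le> C * H powr (\<eta> - 1) / \<delta>"
    proof -
      have "y / 2 \<le> y" if "y \<ge> 0" for y :: real using that by simp
      moreover have "0 \<le> C * H powr (\<eta> - 1) / \<delta>" using C(1) \<delta> by simp
      ultimately show ?thesis by blast
    qed
    finally show "measure unit_lborel {x \<in> {0..<1}. \<forall>d\<in>D. real d * x \<notin> near_int \<delta>}
         \<le> C * real (card D) powr (\<eta> - 1) / \<delta>" by (simp add: H_def)
  qed
qed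

text \<open>The endpoint 1 is a null set, and completing the measure preserves almost everywhere
  statements.\<close>

lemma AE_lebesgue_on_unit_interval:
  assumes "AE x in unit_lborel. P x"
  shows "AE x in lebesgue_on {0..1}. P x"
proof -
  have "AE x in lborel. x \<in> {0..<1} \<longrightarrow> P x"
    using assms by (subst (asm) AE_restrict_space_iff) auto
  moreover have "AE x in lborel. x \<noteq> (1 :: real)" by (rule AE_lborel_singleton)
  ultimately have "AE x in lborel. x \<in> {0..1} \<longrightarrow> P x"
    by eventually_elim auto
  then have "AE x in lebesgue. x \<in> {0..1} \<longrightarrow> P x" by (rule AE_completion)
  then show ?thesis by (subst AE_restrict_space_iff) auto
qed

subsection \<open>Integer parts of differences\<close>

text \<open>Natural numbers fit the gcd sums; as the floors are nonnegative, \<open>nat\<close>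
  merges none of them.\<close>

definition floor_diffs :: "(nat \<Rightarrow> real) \<Rightarrow> nat \<Rightarrow> nat set" where
  "floor_diffs a N = (\<lambda>(m, n). nat \<lfloor>\<bar>a m - a n\<bar>\<rfloor>) ` index_pairs N"

lemma finite_index_pairs: "finite (index_pairs N)"
  by (rule finite_subset[of _ "{1..N} \<times> {1..N}"]) (auto simp: index_pairs_def)

lemma finite_floor_diffs: "finite (floor_diffs a N)"
  by (simp add: floor_diffs_def finite_index_pairs)

lemma floor_diffs_mono: "M \<le> N \<Longrightarrow> floor_diffs a M \<subseteq> floor_diffs a N"
  unfolding floor_diffs_def index_pairs_def by (intro image_mono) auto

lemma card_floor_diffs: "card (floor_diffs a N) = num_floor_diffs a N"
proof -
  let ?F = "(\<lambda>(m, n). \<lfloor>\<bar>a m - a n\<bar>\<rfloor>) ` index_pairs N"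
  have "floor_diffs a N = nat ` ?F"
    by (simp add: floor_diffs_def image_image case_prod_unfold)
  moreover have "inj_on nat ?F" by (rule inj_onI) (auto simp: eq_nat_nat_iff)
  ultimately show ?thesis by (simp add: card_image num_floor_diffs_def)
qed

lemma num_floor_diffs_le_square: "num_floor_diffs a N \<le> N\<^sup>2"
proof -
  have "num_floor_diffs a N \<le> card (index_pairs N)"
    unfolding num_floor_diffs_def by (rule card_image_le[OF finite_index_pairs])
  also have "\<dots> \<le> card ({1..N} \<times> {1..N})"
    by (rule card_mono) (auto simp: index_pairs_def)
  finally show ?thesis by (simp add: card_cartesian_product power2_eq_square)
qed

text \<open>Measured from the smallest of the \<open>N\<close> values, the other
  \<open>N - 1\<close> lie at distances that differ pairwise by at least 1, so their floors are
  distinct. In particular the number of differences tends to infinity.\<close>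

lemma le_Suc_num_floor_diffs:
  assumes sep: "\<And>m n. (m, n) \<in> index_pairs N \<Longrightarrow> \<bar>a m - a n\<bar> \<ge> 1"
  shows "N \<le> Suc (num_floor_diffs a N)"
proof (cases "N = 0")
  case False
  obtain n0 where n0: "n0 \<in> {1..N}" "\<And>n. n \<in> {1..N} \<Longrightarrow> a n0 \<le> a n"
    using False arg_min_if_finite(1)[of "{1..N}" a] arg_min_least[of "{1..N}" _ a] by (metis atLeastAtMost_iff
      empty_iff finite_atLeastAtMost le_refl less_one linorder_not_le)
  have "card ({1..N} - {n0}) \<le> num_floor_diffs a N"
    unfolding num_floor_diffs_def
  proof (rule card_inj_on_le[of "\<lambda>n. \<lfloor>\<bar>a n - a n0\<bar>\<rfloor>"])
    show "inj_on (\<lambda>n. \<lfloor>\<bar>a n - a n0\<bar>\<rfloor>) ({1..N} - {n0})"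
    proof (rule inj_onI, rule ccontr)
      fix m n assume mn: "m \<in> {1..N} - {n0}" "n \<in> {1..N} - {n0}" "m \<noteq> n"
        and eq: "\<lfloor>\<bar>a m - a n0\<bar>\<rfloor> = \<lfloor>\<bar>a n - a n0\<bar>\<rfloor>"
      have "a m \<ge> a n0" "a n \<ge> a n0" using n0(2) mn by auto
      then have "\<bar>a m - a n\<bar> < 1" using eq by linarith
      moreover have "(m, n) \<in> index_pairs N" using mn by (auto simp: index_pairs_def)
      ultimately show False using sep[of m n] by simp
    qed
    show "(\<lambda>n. \<lfloor>\<bar>a n - a n0\<bar>\<rfloor>) ` ({1..N} - {n0}) \<subseteq> (\<lambda>(m, n). \<lfloor>\<bar>a m - a n\<bar>\<rfloor>) ` index_pairs N"
      using n0(1) by (auto simp: index_pairs_def intro!: image_eqI[of _ _ "(_, n0)"])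
    show "finite ((\<lambda>(m, n). \<lfloor>\<bar>a m - a n\<bar>\<rfloor>) ` index_pairs N)"
      by (simp add: finite_index_pairs)
  qed
  then show ?thesis using n0(1) by simp
qed simp

lemma floor_delta_min_le:
  assumes "d \<in> floor_diffs a N" "real d * \<alpha> \<in> near_int \<delta>"
  shows "floor_delta_min a \<alpha> N \<le> \<delta>"
proof -
  obtain m n where mn: "(m, n) \<in> index_pairs N" "d = nat \<lfloor>\<bar>a m - a n\<bar>\<rfloor>"
    using assms(1) by (auto simp: floor_diffs_def)
  have "real d = of_int \<lfloor>\<bar>a m - a n\<bar>\<rfloor>" using mn(2) by simp
  then have "dist_int (\<alpha> * of_int \<lfloor>\<bar>a m - a n\<bar>\<rfloor>) \<le> \<delta>"
    using assms(2) by (simp add: near_int_def mult.commute)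
  moreover have "floor_delta_min a \<alpha> N \<le> dist_int (\<alpha> * of_int \<lfloor>\<bar>a m - a n\<bar>\<rfloor>)"
    unfolding floor_delta_min_def using mn(1) finite_index_pairs
    by (intro Min_le) (auto intro!: image_eqI[of _ _ "(m, n)"])
  ultimately show ?thesis by linarith
qed

section \<open>Dyadic blocks and the Borel-Cantelli lemma\<close>

theorem mainTheorem5:
  fixes a :: "nat \<Rightarrow> real" and \<epsilon> :: real
  assumes "inj_on a {1..}"
    and "\<And>n. n \<ge> 1 \<Longrightarrow> a n > 0"
    and "\<And>N. (INF (m, n)\<in>index_pairs N. ereal \<bar>a m - a n\<bar>) \<ge> 1"
    and "\<epsilon> > 0"
  shows "AE \<alpha> in lebesgue_on {0..1}. \<forall>\<^sub>F N in sequentially.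
           floor_delta_min a \<alpha> N \<le> real N powr \<epsilon> / real (num_floor_diffs a N)"
proof -
  have sep: "\<bar>a m - a n\<bar> \<ge> 1" if "(m, n) \<in> index_pairs N" for m n N
  proof -
    have "1 \<le> (case (m, n) of (m, n) \<Rightarrow> ereal \<bar>a m - a n\<bar>)"
      by (rule order_trans[OF assms(3) INF_lower[OF that]])
    then show ?thesis by simp
  qed
  let ?D = "floor_diffs a" and ?H = "num_floor_diffs a"
  have D0: "0 \<notin> ?D N" for N
    using sep by (fastforce simp: floor_diffs_def)
  \<comment> \<open>The final estimate loses \<open>N powr (8 * \<theta>)\<close>, so
    \<open>8 * \<theta> \<le> \<epsilon>\<close> is needed; the minimum with 1 keeps the exponent
    \<open>2 * \<theta> - 1\<close> of \<open>\<delta> k\<close> negative.\<close>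
  define \<theta> where "\<theta> = min \<epsilon> 1 / 8"
  have \<theta>: "0 < \<theta>" "\<theta> \<le> 1 / 8" "8 * \<theta> \<le> \<epsilon>" using assms(4) by (auto simp: \<theta>_def)
  obtain C where C: "C > 0"
    "\<And>D \<delta>. finite D \<Longrightarrow> 0 \<notin> D \<Longrightarrow> D \<noteq> {} \<Longrightarrow> 0 < \<delta> \<Longrightarrow> 2 * \<delta> < 1 \<Longrightarrow>
       measure unit_lborel {x \<in> {0..<1}. \<forall>d\<in>D. real d * x \<notin> near_int \<delta>}
         \<le> C * real (card D) powr (\<theta> - 1) / \<delta>"
    using measure_far_from_int_powr_le[OF \<theta>(1)] by blast
  define P where "P k N \<longleftrightarrow> 2 ^ k \<le> ?H N \<and> ?H N < 2 ^ (k + 1)" for k N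
  define \<delta> where "\<delta> k = (2 ^ k) powr (2 * \<theta> - 1)" for k :: nat
  \<comment> \<open>The number of differences may jump over a whole dyadic block; such \<open>k\<close> are never used.\<close>
  define B where "B k = (if k \<ge> 2 \<and> (\<exists>N. P k N)
    then {x \<in> {0..<1}. \<forall>d\<in>?D (LEAST N. P k N). real d * x \<notin> near_int (\<delta> k)} else {})" for k
  have B_sets: "B k \<in> sets unit_lborel" for k
    using finite_floor_diffs by (auto simp: B_def sets_restrict_space_iff)
  have B_le: "measure unit_lborel (B k) \<le> C * (2 powr - \<theta>) ^ k" for k
  proof (cases "k \<ge> 2 \<and> (\<exists>N. P k N)")
    case True
    define N where "N = (LEAST N. P k N)"
    have PN: "P k N" unfolding N_def using True by (auto intro: LeastI)
    then have H: "2 ^ k \<le> card (?D N)" by (simp add: P_def card_floor_diffs)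
    then have ne: "?D N \<noteq> {}" by auto
    have "2 * \<delta> k < 1"
    proof -
      \<comment> \<open>Since \<open>k \<ge> 2\<close> and \<open>\<theta> \<le> 1 / 8\<close>, the
        exponent of 2 in \<open>2 * \<delta> k\<close> is at most \<open>- 1 / 2\<close>.\<close>
      have "real k * (2 * \<theta> - 1) \<le> 2 * (2 * \<theta> - 1)"
        using True \<theta> by (intro mult_right_mono_neg) auto
      then have "1 + real k * (2 * \<theta> - 1) < 0" using \<theta> by simp
      then have "2 powr (1 + real k * (2 * \<theta> - 1)) < 1"
        using powr_less_mono[of _ 0 "2 :: real"] by force
      then show ?thesis by (simp add: \<delta>_def powr_add powr_powr flip: powr_realpow)
    qed
    moreover have "\<delta> k > 0" by (simp add: \<delta>_def)
    ultimately have "measure unit_lborel (B k) \<le> C * real (card (?D N)) powr (\<theta> - 1) / \<delta> k"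
      using True C(2)[OF finite_floor_diffs D0 ne] by (simp add: B_def N_def)
    also have "\<dots> \<le> C * (2 ^ k) powr (\<theta> - 1) / \<delta> k"
    proof -
      have "real (2 ^ k) \<le> real (card (?D N))" using H by (rule of_nat_mono)
      then have "real (card (?D N)) powr (\<theta> - 1) \<le> (2 ^ k) powr (\<theta> - 1)"
        using \<theta> by (intro powr_mono2') auto
      then show ?thesis using C(1) \<open>\<delta> k > 0\<close> by (intro divide_right_mono mult_left_mono) auto
    qed
    also have "\<dots> = C * (2 ^ k) powr - \<theta>"
    proof -
      have "(2 ^ k) powr (\<theta> - 1) = (2 ^ k) powr - \<theta> * \<delta> k"
        by (simp add: \<delta>_def flip: powr_add)
      then show ?thesis using \<open>\<delta> k > 0\<close> by simp
    qed
    also have "(2 ^ k) powr - \<theta> = (2 powr - \<theta>) ^ k"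
      by (simp add: powr_powr mult.commute flip: powr_realpow)
    finally show ?thesis .
  next
    case False
    then have "B k = {}" by (simp only: B_def if_False)
    then show ?thesis using C(1) by simp
  qed
  have "AE x in unit_lborel. eventually (\<lambda>k. x \<in> space unit_lborel - B k) sequentially"
  proof (rule borel_cantelli_AE1)
    have "2 powr - \<theta> < 1" using powr_less_mono[of "- \<theta>" 0 2] \<theta> by simp
    then have "summable (\<lambda>k. C * (2 powr - \<theta>) ^ k)"
      by (intro summable_mult summable_geometric) simp
    then show "summable (\<lambda>k. measure unit_lborel (B k))"
      by (rule summable_comparison_test'[where N = 0]) (simp add: B_le)
  qed (use B_sets in \<open>auto simp: less_top[symmetric]\<close>)
  then have "AE \<alpha> in unit_lborel. \<forall>\<^sub>F N in sequentially.
           floor_delta_min a \<alpha> N \<le> real N powr \<epsilon> / real (?H N)"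
  proof eventually_elim
    fix \<alpha> assume "eventually (\<lambda>k. \<alpha> \<in> space unit_lborel - B k) sequentially"
    then obtain K where K: "\<And>k. k \<ge> K \<Longrightarrow> \<alpha> \<in> {0..<1} - B k"
      by (auto simp: eventually_sequentially)
    \<comment> \<open>Beyond \<open>K\<close> no exceptional set contains \<open>\<alpha>\<close>;
      \<open>k \<ge> 2\<close> makes \<open>B k\<close> the genuine exceptional set; the last bound
      gives \<open>(2 ^ k) powr (2 * \<theta>) \<ge> 2\<close>, which absorbs the ratio 2 between
      the ends of a block.\<close>
    define L where "L = max K (max 2 (nat \<lceil>1 / (2 * \<theta>)\<rceil>))"
    show "\<forall>\<^sub>F N in sequentially. floor_delta_min a \<alpha> N \<le> real N powr \<epsilon> / real (?H N)"
      \<comment> \<open>The successor compensates for \<open>N \<le> Suc (?H N)\<close>, so that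
        \<open>?H N\<close> reaches \<open>2 ^ L\<close>.\<close>
      using eventually_ge_at_top[of "Suc (2 ^ L)"]
    proof eventually_elim
      fix N :: nat assume N: "N \<ge> Suc (2 ^ L)"
      have "N \<le> Suc (?H N)" by (rule le_Suc_num_floor_diffs, rule sep)
      with N have HL: "2 ^ L \<le> ?H N" by simp
      then have H1: "?H N \<ge> 1" by (meson le_trans one_le_numeral one_le_power)
      obtain k where k: "2 ^ k \<le> ?H N" "?H N < 2 ^ (k + 1)"
        using ex_power_ivl1[OF _ H1, of 2] by auto
      have "(2::nat) ^ L < 2 ^ (k + 1)" using HL k by simp
      then have "L < k + 1" by (rule power_less_imp_less_exp[rotated]) simp
      then have kL: "k \<ge> K" "k \<ge> 2" "k \<ge> nat \<lceil>1 / (2 * \<theta>)\<rceil>" unfolding L_def by linarith+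
      have PN: "P k N" using k by (simp add: P_def)
      define M where "M = (LEAST N. P k N)"
      have "M \<le> N" unfolding M_def by (rule Least_le[of "P k", OF PN])
      have "\<alpha> \<in> {0..<1}" "\<alpha> \<notin> B k" using K[OF kL(1)] by auto
      then obtain d where d: "d \<in> ?D M" "real d * \<alpha> \<in> near_int (\<delta> k)"
        using kL(2) PN by (auto simp: B_def M_def split: if_splits)
      \<comment> \<open>The difference \<open>d\<close> found at the first index \<open>M\<close> of
        the block is still available at \<open>N\<close>.\<close>
      then have "floor_delta_min a \<alpha> N \<le> \<delta> k"
        using floor_diffs_mono[OF \<open>M \<le> N\<close>] by (intro floor_delta_min_le[of d]) auto
      also have "\<delta> k \<le> (2 ^ k) powr (4 * \<theta>) / 2 ^ (k + 1)"
      proof -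
        have "1 / (2 * \<theta>) \<le> k" using kL(3) by linarith
        then have "1 \<le> k * (2 * \<theta>)" using \<theta> by (simp add: field_simps)
        then have "2 powr 1 \<le> 2 powr (k * (2 * \<theta>))" by (intro powr_mono) auto
        then have "2 \<le> (2 ^ k) powr (2 * \<theta>)"
          by (simp add: powr_powr flip: powr_realpow)
        then have "2 * (2 ^ k) powr (2 * \<theta>) \<le> (2 ^ k) powr (2 * \<theta>) * (2 ^ k) powr (2 * \<theta>)"
          by (intro mult_right_mono) auto
        also have "\<dots> = (2 ^ k) powr (4 * \<theta>)" by (simp flip: powr_add)
        finally show ?thesis
          by (simp add: \<delta>_def powr_diff field_simps)
      qed
      also have "\<dots> \<le> real N powr \<epsilon> / real (?H N)"
      proof (intro frac_le)
        \<comment> \<open>The trivial bound \<open>?H N \<le> N\<^sup>2\<close> turns the loss in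
          terms of \<open>2 ^ k\<close> into a power of \<open>N\<close>.\<close>
        have "2 ^ k \<le> N\<^sup>2" using k(1) num_floor_diffs_le_square[of a N] by linarith
        then have "real (2 ^ k) \<le> real (N\<^sup>2)" by (rule of_nat_mono)
        then have "(2 ^ k) powr (4 * \<theta>) \<le> (real N ^ 2) powr (4 * \<theta>)"
          using \<theta> by (intro powr_mono2) auto
        also have "\<dots> = real N powr (8 * \<theta>)"
          using N by (simp add: powr_powr flip: powr_numeral)
        also have "\<dots> \<le> real N powr \<epsilon>" using N \<theta> by (intro powr_mono) auto
        finally show "(2 ^ k) powr (4 * \<theta>) \<le> real N powr \<epsilon>" .
        have "real (?H N) \<le> real (2 ^ (k + 1))" using k(2) by (intro of_nat_mono) simp
        then show "real (?H N) \<le> 2 ^ (k + 1)" by simp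
      qed (use H1 in auto)
      finally show "floor_delta_min a \<alpha> N \<le> real N powr \<epsilon> / real (?H N)" .
    qed
  qed
  then show ?thesis by (rule AE_lebesgue_on_unit_interval)
qed

end
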